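(* Let $A \subseteq \omega$ and let $\mathcal{C} \subseteq [\omega]^\omega$ be a Ramsey-like class. If there is a Turing functional $\Phi$ such that $\Phi^H = A$ for every $H \in \mathcal{C}$, then for every $H \in \mathcal{C}$, the principal function $p_H$ is a uniform modulus of $A$.
   Context: $[X]^\omega$ denotes the class of infinite subsets of $X$. A class $\mathcal{C} \subseteq [\omega]^\omega$ is dense if for every $X \in [\omega]^\omega$, $[X]^\omega \cap \mathcal{C} \neq \emptyset$; it is downward-closed if for every $X \in \mathcal{C}$, $[X]^\omega \subseteq \mathcal{C}$; it is Ramsey-like if it is dense and downward-closed. The principal function of an infinite set $X = \{x_0 < x_1 < \dots\}$ is $p_X(n) = x_n$. A function $h$ dominates a function $f$ if $h(x) \geq f(x)$ for every $x$. A function $g$ is a uniform modulus for $A$ if there is a Turing functional $\Psi$ such that $\Psi^f = A$ for every function $f$ dominating $g$. *)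

theory Defs
  imports Main "HOL-Library.Infinite_Set" "HOL-Library.Indicator_Function"
begin

text \<open>
  Turing functionals are modelled as Kleene's partial recursive functionals: the programs below
  compute from a function \<open>f\<close> on the natural numbers, which \<open>Query\<close> consults.
\<close>

datatype prog =
    Zero
  | Succ
  | Proj nat
  | Query
  | Comp prog "prog list"
  | PrimRec prog prog
  | Mu prog

text \<open>
  The partial function computed relative to \<open>f\<close>; \<open>None\<close> means divergence. Arities are not typed:
  \<open>Succ\<close> and \<open>Query\<close> diverge unless given exactly one argument, \<open>Proj i\<close> diverges if there is no
  argument number \<open>i\<close> (counting from \<open>0\<close>), and \<open>Zero\<close> is the zero function of every arity.
  Composition is strict in all its arguments. In \<open>Mu p\<close>, every value of \<open>p\<close> before the first zero
  has to be defined.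
\<close>

primrec run :: "prog \<Rightarrow> (nat \<Rightarrow> nat) \<Rightarrow> nat list \<Rightarrow> nat option" where
  "run Zero = (\<lambda>f xs. Some 0)"
| "run Succ = (\<lambda>f xs. case xs of [x] \<Rightarrow> Some (Suc x) | _ \<Rightarrow> None)"
| "run (Proj i) = (\<lambda>f xs. if i < length xs then Some (xs ! i) else None)"
| "run Query = (\<lambda>f xs. case xs of [x] \<Rightarrow> Some (f x) | _ \<Rightarrow> None)"
| "run (Comp p qs) = (\<lambda>f xs. Option.bind (those (map (\<lambda>r. r f xs) (map run qs))) (run p f))"
| "run (PrimRec p q) = (\<lambda>f xs. case xs of [] \<Rightarrow> None
     | n # ys \<Rightarrow> rec_nat (run p f ys) (\<lambda>k r. Option.bind r (\<lambda>v. run q f (k # v # ys))) n)"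
| "run (Mu p) = (\<lambda>f xs.
     if \<exists>n. run p f (n # xs) = Some 0 \<and> (\<forall>m<n. run p f (m # xs) \<noteq> None)
     then Some (LEAST n. run p f (n # xs) = Some 0) else None)"

definition turing_functional :: "((nat \<Rightarrow> nat) \<Rightarrow> nat \<Rightarrow> nat option) \<Rightarrow> bool" where
  "turing_functional \<Phi> \<longleftrightarrow> (\<exists>p. \<forall>f n. \<Phi> f n = run p f [n])"

text \<open>\<open>\<Phi>\<^sup>f = A\<close>: the functional is total at \<open>f\<close> and yields the characteristic function of \<open>A\<close>.\<close>

definition computes_set ::
    "((nat \<Rightarrow> nat) \<Rightarrow> nat \<Rightarrow> nat option) \<Rightarrow> (nat \<Rightarrow> nat) \<Rightarrow> nat set \<Rightarrow> bool" where
  "computes_set \<Phi> f A \<longleftrightarrow> (\<forall>n. \<Phi> f n = Some (indicator A n))"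

definition infinite_subsets :: "nat set \<Rightarrow> nat set set" where
  "infinite_subsets X = {Y. Y \<subseteq> X \<and> infinite Y}"

definition dense_class :: "nat set set \<Rightarrow> bool" where
  "dense_class C \<longleftrightarrow> (\<forall>X \<in> infinite_subsets UNIV. infinite_subsets X \<inter> C \<noteq> {})"

definition downward_closed :: "nat set set \<Rightarrow> bool" where
  "downward_closed C \<longleftrightarrow> (\<forall>X \<in> C. infinite_subsets X \<subseteq> C)"

definition ramsey_like :: "nat set set \<Rightarrow> bool" where
  "ramsey_like C \<longleftrightarrow> dense_class C \<and> downward_closed C"

text \<open>The library's \<open>enumerate X n\<close> is the \<open>n\<close>-th element of an infinite \<open>X\<close>, counting from \<open>0\<close>.\<close>

definition principal_function :: "nat set \<Rightarrow> nat \<Rightarrow> nat" where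
  "principal_function X = enumerate X"

definition dominates :: "(nat \<Rightarrow> nat) \<Rightarrow> (nat \<Rightarrow> nat) \<Rightarrow> bool" where
  "dominates h f \<longleftrightarrow> (\<forall>x. h x \<ge> f x)"

definition uniform_modulus :: "(nat \<Rightarrow> nat) \<Rightarrow> nat set \<Rightarrow> bool" where
  "uniform_modulus g A \<longleftrightarrow>
     (\<exists>\<Psi>. turing_functional \<Psi> \<and> (\<forall>f. dominates f g \<longrightarrow> computes_set \<Psi> f A))"

end

theory Submission
  imports Defs "HOL-Library.Nat_Bijection"
begin

text \<open>
  Suppose \<open>f\<close> dominates \<open>p\<^sub>H\<close>, so that \<open>a \<le> p\<^sub>H(a) \<le> f a\<close> and \<open>H\<close> meets every interval
  \<open>{a..f a}\<close>. To compute \<open>A(n)\<close> from \<open>f\<close>, search for a bound \<open>N\<close> and a bit \<open>i\<close> such that every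
  \<open>S \<subseteq> {..<N}\<close> meeting all these intervals below \<open>N\<close> has a subset \<open>F\<close> with \<open>\<Phi>\<^sup>F(n) = i\<close>, the computation using only numbers below \<open>N\<close>.
  Such an \<open>N\<close> exists for \<open>i = A(n)\<close>: otherwise, by compactness, some infinite \<open>X\<close> would have no
  subset \<open>Y\<close> with \<open>\<Phi>\<^sup>Y(n) = A(n)\<close>, against density. Conversely, \<open>S = H \<inter> {..<N}\<close> yields such an
  \<open>F \<subseteq> H\<close>, and \<open>F \<union> (H - {..<N})\<close> belongs to \<open>C\<close> by downward closure, so \<open>i = A(n)\<close>.
\<close>

section \<open>Computations with bounded queries and searches\<close>

text \<open>The earlier values are required to be explicit successors, so that the condition speaks
  of convergent values only and persists when \<open>g\<close> becomes defined at more
  arguments.\<close>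

definition first_zero :: "(nat \<Rightarrow> nat option) \<Rightarrow> nat \<Rightarrow> bool" where
  "first_zero g n \<longleftrightarrow> g n = Some 0 \<and> (\<forall>m<n. \<exists>v. g m = Some (Suc v))"

lemma first_zero_unique: "first_zero g m \<Longrightarrow> first_zero g n \<Longrightarrow> m = n"
  unfolding first_zero_def by (metis linorder_neqE_nat nat.distinct(1) option.inject)

lemma The_first_zero: "first_zero g n \<Longrightarrow> (THE n. first_zero g n) = n"
  using first_zero_unique by blast

lemma first_zero_exists_iff:
  "(\<exists>n. first_zero g n) \<longleftrightarrow> (\<exists>n. g n = Some 0 \<and> (\<forall>m<n. g m \<noteq> None))"
proof
  assume "\<exists>n. g n = Some 0 \<and> (\<forall>m<n. g m \<noteq> None)"
  then obtain n where n: "g n = Some 0" "\<forall>m<n. g m \<noteq> None" by blast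
  define l where "l = (LEAST n. g n = Some 0)"
  have "g l = Some 0" unfolding l_def using n(1) by (rule LeastI)
  moreover have "l \<le> n" unfolding l_def using n(1) by (rule Least_le)
  moreover have "g m \<noteq> Some 0" if "m < l" for m
    using that not_less_Least unfolding l_def by blast
  ultimately have "first_zero g l"
    using n(2) unfolding first_zero_def
    by (metis not0_implies_Suc option.exhaust order_less_le_trans)
  then show "\<exists>n. first_zero g n" by blast
qed (fastforce simp: first_zero_def)

lemma Least_first_zero:
  assumes "first_zero g n"
  shows "(LEAST n. g n = Some 0) = n"
  using assms by (intro Least_equality) (force simp: first_zero_def not_less[symmetric])+

text \<open>Both the oracle queries and the searches are confined to \<open>B\<close>, so that \<open>B = UNIV\<close> gives back
  \<open>run\<close> and \<open>B = {..<s}\<close> gives a decidable approximation of it.\<close>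

primrec bounded_run :: "prog \<Rightarrow> nat set \<Rightarrow> (nat \<Rightarrow> nat) \<Rightarrow> nat list \<Rightarrow> nat option" where
  "bounded_run Zero = (\<lambda>B f xs. Some 0)"
| "bounded_run Succ = (\<lambda>B f xs. case xs of [x] \<Rightarrow> Some (Suc x) | _ \<Rightarrow> None)"
| "bounded_run (Proj i) = (\<lambda>B f xs. if i < length xs then Some (xs ! i) else None)"
| "bounded_run Query =
     (\<lambda>B f xs. case xs of [x] \<Rightarrow> if x \<in> B then Some (f x) else None | _ \<Rightarrow> None)"
| "bounded_run (Comp p qs) = (\<lambda>B f xs.
     Option.bind (those (map (\<lambda>r. r B f xs) (map bounded_run qs))) (bounded_run p B f))"
| "bounded_run (PrimRec p q) = (\<lambda>B f xs. case xs of [] \<Rightarrow> None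
     | n # ys \<Rightarrow> rec_nat (bounded_run p B f ys)
         (\<lambda>k r. Option.bind r (\<lambda>v. bounded_run q B f (k # v # ys))) n)"
| "bounded_run (Mu p) = (\<lambda>B f xs.
     if \<exists>n\<in>B. first_zero (\<lambda>n. bounded_run p B f (n # xs)) n
     then Some (THE n. first_zero (\<lambda>n. bounded_run p B f (n # xs)) n) else None)"

lemma those_eq_Some_iff: "those xs = Some ys \<longleftrightarrow> xs = map Some ys"
  by (induction xs arbitrary: ys) (auto split: option.splits simp: Cons_eq_map_conv)

lemma map_eq_map_Some_iff: "map h qs = map Some ys \<longleftrightarrow> list_all2 (\<lambda>q y. h q = Some y) qs ys"
  by (simp add: list_all2_conv_all_nth list_eq_iff_nth_eq) auto

lemma bounded_run_Comp_eq_Some_iff: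
  "bounded_run (Comp p qs) B f xs = Some v \<longleftrightarrow>
     (\<exists>ys. list_all2 (\<lambda>q y. bounded_run q B f xs = Some y) qs ys \<and> bounded_run p B f ys = Some v)"
  by (simp add: bind_eq_Some_conv those_eq_Some_iff map_eq_map_Some_iff comp_def)

lemma bounded_run_Mu_eq_Some_iff:
  "bounded_run (Mu p) B f xs = Some n \<longleftrightarrow>
     n \<in> B \<and> first_zero (\<lambda>n. bounded_run p B f (n # xs)) n"
  using The_first_zero[of "\<lambda>n. bounded_run p B f (n # xs)"] by auto

declare bounded_run.simps(5,7) [simp del]

lemma bounded_run_UNIV: "bounded_run p UNIV f xs = run p f xs"
proof (induction p arbitrary: xs)
  case (Comp p qs)
  then have "map (\<lambda>r. r UNIV f xs) (map bounded_run qs) = map (\<lambda>r. r f xs) (map run qs)"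
    unfolding map_map by (intro map_cong) simp_all
  moreover have "bounded_run p UNIV f = run p f"
    using Comp by blast
  ultimately show ?case
    unfolding bounded_run.simps run.simps by presburger
next
  case (PrimRec p q)
  then show ?case by (auto split: list.splits)
next
  case (Mu p)
  let ?g = "\<lambda>n. run p f (n # xs)"
  show ?case
  proof (cases "\<exists>n. first_zero ?g n")
    case True
    then obtain n where n: "first_zero ?g n" by blast
    with True show ?thesis
      by (simp add: bounded_run.simps(7) Mu The_first_zero[OF n] Least_first_zero[OF n]
          first_zero_exists_iff del: not_None_eq)
  next
    case False
    then show ?thesis
      unfolding bounded_run.simps run.simps Mu first_zero_exists_iff[symmetric] by simp
  qed
qed (auto split: list.splits)

text \<open>The use principle: a convergent computation rests on finitely many convergent
  subcomputations and reads the oracle only inside \<open>B\<close>, so it survives a larger bound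
  and any change of the oracle outside \<open>B\<close>.\<close>

lemma bounded_run_mono:
  assumes "bounded_run p B f xs = Some v" and "B \<subseteq> B'" and "\<And>x. x \<in> B \<Longrightarrow> f x = g x"
  shows "bounded_run p B' g xs = Some v"
  using assms(1)
proof (induction p arbitrary: xs v)
  case Query
  then show ?case using assms(2,3) by (auto split: list.splits if_splits)
next
  case (Comp p qs)
  from Comp.prems obtain ys
    where ys: "list_all2 (\<lambda>q y. bounded_run q B f xs = Some y) qs ys" "bounded_run p B f ys = Some v"
    unfolding bounded_run_Comp_eq_Some_iff by blast
  have "list_all2 (\<lambda>q y. bounded_run q B' g xs = Some y) qs ys"
    using ys(1) by (rule list.rel_mono_strong) (rule Comp.IH(2))
  with Comp.IH(1)[OF ys(2)] show ?case
    unfolding bounded_run_Comp_eq_Some_iff by blast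
next
  case (PrimRec p q)
  from PrimRec.prems obtain n ys where xs: "xs = n # ys" by (auto split: list.splits)
  have "rec_nat (bounded_run p B' g ys)
          (\<lambda>k r. Option.bind r (\<lambda>v. bounded_run q B' g (k # v # ys))) n = Some v"
    if "rec_nat (bounded_run p B f ys)
          (\<lambda>k r. Option.bind r (\<lambda>v. bounded_run q B f (k # v # ys))) n = Some v" for n v
    using that by (induction n arbitrary: v) (auto simp: bind_eq_Some_conv PrimRec.IH)
  with PrimRec.prems show ?case by (simp add: xs)
next
  case (Mu p)
  then have "v \<in> B" "first_zero (\<lambda>n. bounded_run p B f (n # xs)) v"
    by (simp_all add: bounded_run_Mu_eq_Some_iff)
  then show ?case
    using Mu.IH assms(2) unfolding bounded_run_Mu_eq_Some_iff first_zero_def by blast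
qed (auto split: list.splits)

lemma eventually_list_all2:
  assumes "list_all2 (\<lambda>x y. eventually (\<lambda>s. P s x y) F) xs ys"
  shows "eventually (\<lambda>s. list_all2 (P s) xs ys) F"
  using assms by (induction rule: list_all2_induct) (auto intro: eventually_conj)

text \<open>A convergent computation makes finitely many queries, and its searches return finitely
  many values. Stating this with \<open>eventually\<close> lets the bounds of the subcomputations be
  combined.\<close>

lemma eventually_bounded_run:
  assumes "run p f xs = Some v"
  shows "\<forall>\<^sub>F s in sequentially. bounded_run p {..<s} f xs = Some v"
proof -
  have "bounded_run p UNIV f xs = Some v" using assms by (simp add: bounded_run_UNIV)
  then show ?thesis
  proof (induction p arbitrary: xs v)
    case Query
    then obtain x where x: "xs = [x]" "f x = v" by (auto split: list.splits)
    show ?case using eventually_gt_at_top[of x] by eventually_elim (use x in simp)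
  next
    case (Comp p qs)
    from Comp.prems obtain ys
      where ys: "list_all2 (\<lambda>q y. bounded_run q UNIV f xs = Some y) qs ys"
        "bounded_run p UNIV f ys = Some v"
      unfolding bounded_run_Comp_eq_Some_iff by blast
    have "list_all2 (\<lambda>q y. \<forall>\<^sub>F s in sequentially. bounded_run q {..<s} f xs = Some y) qs ys"
      using ys(1) by (rule list.rel_mono_strong) (rule Comp.IH(2))
    from eventually_list_all2[OF this] Comp.IH(1)[OF ys(2)] show ?case
      by eventually_elim (use bounded_run_Comp_eq_Some_iff in blast)
  next
    case (PrimRec p q)
    from PrimRec.prems obtain n ys where xs: "xs = n # ys" by (auto split: list.splits)
    have "\<forall>\<^sub>F s in sequentially. rec_nat (bounded_run p {..<s} f ys)
            (\<lambda>k r. Option.bind r (\<lambda>v. bounded_run q {..<s} f (k # v # ys))) n = Some v"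
      if "rec_nat (bounded_run p UNIV f ys)
            (\<lambda>k r. Option.bind r (\<lambda>v. bounded_run q UNIV f (k # v # ys))) n = Some v" for n v
      using that
    proof (induction n arbitrary: v)
      case 0
      then show ?case using PrimRec.IH(1) by simp
    next
      case (Suc n)
      then obtain w where
        "rec_nat (bounded_run p UNIV f ys)
           (\<lambda>k r. Option.bind r (\<lambda>v. bounded_run q UNIV f (k # v # ys))) n = Some w"
        and w: "bounded_run q UNIV f (n # w # ys) = Some v"
        by (auto simp: bind_eq_Some_conv)
      from Suc.IH[OF this(1)] PrimRec.IH(2)[OF w] show ?case
        by eventually_elim simp
    qed
    with PrimRec.prems show ?case by (simp add: xs)
  next
    case (Mu p)
    then have *: "first_zero (\<lambda>n. bounded_run p UNIV f (n # xs)) v"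
      by (simp add: bounded_run_Mu_eq_Some_iff)
    \<comment> \<open>Fixing the values \<open>w m\<close> in advance reduces the search to finitely
      many convergent computations with known results.\<close>
    then obtain w where w: "\<And>m. m < v \<Longrightarrow> bounded_run p UNIV f (m # xs) = Some (Suc (w m))"
      unfolding first_zero_def by metis
    have "\<forall>\<^sub>F s in sequentially. \<forall>m\<in>{..<v}. bounded_run p {..<s} f (m # xs) = Some (Suc (w m))"
      using w Mu.IH by (intro eventually_ball_finite) auto
    moreover have "\<forall>\<^sub>F s in sequentially. bounded_run p {..<s} f (v # xs) = Some 0"
      using * Mu.IH unfolding first_zero_def by blast
    ultimately show ?case using eventually_gt_at_top[of v]
      by eventually_elim (auto simp: bounded_run_Mu_eq_Some_iff first_zero_def)
  qed (auto split: list.splits)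
qed

section \<open>Total computable functionals\<close>

definition computable :: "nat \<Rightarrow> ((nat \<Rightarrow> nat) \<Rightarrow> nat list \<Rightarrow> nat) \<Rightarrow> bool" where
  "computable k F \<longleftrightarrow> (\<exists>p. \<forall>f xs. length xs = k \<longrightarrow> run p f xs = Some (F f xs))"

text \<open>This is the form in which \<open>Comp\<close> takes its argument programs;
  \<open>m\<close> becomes the arity of the outer one.\<close>

definition computable_list :: "nat \<Rightarrow> nat \<Rightarrow> ((nat \<Rightarrow> nat) \<Rightarrow> nat list \<Rightarrow> nat list) \<Rightarrow> bool" where
  "computable_list k m L \<longleftrightarrow> (\<exists>qs. length qs = m \<and>
     (\<forall>f xs. length xs = k \<longrightarrow> map (\<lambda>q. run q f xs) qs = map Some (L f xs)))"

abbreviation decidable :: "nat \<Rightarrow> ((nat \<Rightarrow> nat) \<Rightarrow> nat list \<Rightarrow> bool) \<Rightarrow> bool" where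
  "decidable k P \<equiv> computable k (\<lambda>f xs. of_bool (P f xs))"

text \<open>The argument list serves as an environment: in the premises of the rules for binding
  operators, \<open>hd xs\<close> stands for the bound variable and \<open>tl xs\<close> for the enclosing environment.\<close>

named_theorems computable_intros

section \<open>Environments, substitution and primitive recursion\<close>

lemma computable_cong:
  assumes "computable k F" and "\<And>f xs. length xs = k \<Longrightarrow> F f xs = G f xs"
  shows "computable k G"
  using assms unfolding computable_def by metis

lemma computable_list_cong:
  assumes "computable_list k m L" and "\<And>f xs. length xs = k \<Longrightarrow> L f xs = M f xs"
  shows "computable_list k m M"
  using assms unfolding computable_list_def by metis

lemma computable_list_Nil [computable_intros]: "computable_list k 0 (\<lambda>f xs. [])"
  unfolding computable_list_def by simp

lemma computable_list_Cons [computable_intros]: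
  assumes "computable k F" and "computable_list k m L"
  shows "computable_list k (Suc m) (\<lambda>f xs. F f xs # L f xs)"
proof -
  from assms obtain q qs where
    "\<And>f xs. length xs = k \<Longrightarrow> run q f xs = Some (F f xs)" "length qs = m"
    "\<And>f xs. length xs = k \<Longrightarrow> map (\<lambda>q. run q f xs) qs = map Some (L f xs)"
    unfolding computable_def computable_list_def by blast
  then show ?thesis
    unfolding computable_list_def by (intro exI[of _ "q # qs"]) simp
qed

lemma computable_list_map:
  assumes "\<And>q. q \<in> set qs \<Longrightarrow> computable k (\<lambda>f xs. F q f xs)"
  shows "computable_list k (length qs) (\<lambda>f xs. map (\<lambda>q. F q f xs) qs)"
  using assms by (induction qs) (auto intro: computable_intros)

lemma computable_nth: "i < k \<Longrightarrow> computable k (\<lambda>f xs. xs ! i)"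
  unfolding computable_def by (intro exI[of _ "Proj i"]) simp

lemma computable_list_drop: "m + j = k \<Longrightarrow> computable_list k m (\<lambda>f xs. drop j xs)"
proof (rule computable_list_cong)
  assume "m + j = k"
  then show "computable_list k m (\<lambda>f xs. map (\<lambda>i. xs ! i) [j..<k])"
    using computable_list_map[of "[j..<k]" k "\<lambda>i f xs. xs ! i"] computable_nth by auto
qed (auto simp: list_eq_iff_nth_eq)


lemma funpow_tl: "(tl ^^ j) xs = drop j xs"
  by (induction j arbitrary: xs) (simp_all add: drop_Suc tl_drop)

lemma computable_list_funpow_tl: "computable_list (k + j) k (\<lambda>f xs. (tl ^^ j) xs)"
  by (simp add: funpow_tl computable_list_drop)

lemma computable_hd_funpow_tl: "computable (Suc k + j) (\<lambda>f xs. hd ((tl ^^ j) xs))"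
  by (rule computable_cong[OF computable_nth[of j]]) (simp_all add: funpow_tl hd_drop_conv_nth)

text \<open>Variables act as de Bruijn indices. The powers of \<open>tl\<close> are unfolded so that
  these instances match the goals literally.\<close>

lemmas computable_list_tl [computable_intros] =
  computable_list_funpow_tl[where j = 0, simplified]
  computable_list_funpow_tl[where j = "Suc 0", simplified]
  computable_list_funpow_tl[where j = "Suc (Suc 0)", simplified]
  computable_list_funpow_tl[where j = "Suc (Suc (Suc 0))", simplified]
  computable_list_funpow_tl[where j = "Suc (Suc (Suc (Suc 0)))", simplified]

lemmas computable_hd_tl [computable_intros] =
  computable_hd_funpow_tl[where j = 0, simplified]
  computable_hd_funpow_tl[where j = "Suc 0", simplified]
  computable_hd_funpow_tl[where j = "Suc (Suc 0)", simplified]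
  computable_hd_funpow_tl[where j = "Suc (Suc (Suc 0))", simplified]
  computable_hd_funpow_tl[where j = "Suc (Suc (Suc (Suc 0)))", simplified]

lemma computable_comp:
  assumes "computable m G" and "computable_list k m L"
  shows "computable k (\<lambda>f xs. G f (L f xs))"
proof -
  from assms obtain p qs where p: "\<And>f xs. length xs = m \<Longrightarrow> run p f xs = Some (G f xs)"
    and qs: "length qs = m"
    "\<And>f xs. length xs = k \<Longrightarrow> map (\<lambda>q. run q f xs) qs = map Some (L f xs)"
    unfolding computable_def computable_list_def by blast
  have "run (Comp p qs) f xs = Some (G f (L f xs))" if "length xs = k" for f xs
  proof -
    have "those (map (\<lambda>r. r f xs) (map run qs)) = Some (L f xs)"
      using qs(2)[OF that] by (simp add: those_eq_Some_iff comp_def)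
    moreover have "length (L f xs) = m"
      using qs(1) arg_cong[OF qs(2)[OF that], of length] by simp
    ultimately show ?thesis
      by (simp add: p)
  qed
  then show ?thesis
    unfolding computable_def by blast
qed

lemma computable_tl: "computable k F \<Longrightarrow> computable (Suc k) (\<lambda>f xs. F f (tl xs))"
  by (erule computable_comp) (rule computable_list_tl)

lemma computable_0 [computable_intros]: "computable k (\<lambda>f xs. 0)"
  unfolding computable_def by (intro exI[of _ Zero]) simp

lemma computable_Suc [computable_intros]:
  assumes "computable k F"
  shows "computable k (\<lambda>f xs. Suc (F f xs))"
proof -
  have "computable 1 (\<lambda>f xs. Suc (hd xs))"
    unfolding computable_def by (intro exI[of _ Succ]) (auto simp: length_Suc_conv)
  from computable_comp[OF this, of k "\<lambda>f xs. [F f xs]"] assms show ?thesis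
    by (simp add: computable_intros)
qed

lemma computable_oracle [computable_intros]:
  assumes "computable k F"
  shows "computable k (\<lambda>f xs. f (F f xs))"
proof -
  have "computable 1 (\<lambda>f xs. f (hd xs))"
    unfolding computable_def by (intro exI[of _ Query]) (auto simp: length_Suc_conv)
  from computable_comp[OF this, of k "\<lambda>f xs. [F f xs]"] assms show ?thesis
    by (simp add: computable_intros)
qed

lemma computable_const [computable_intros]: "computable k (\<lambda>f xs. c)"
  by (induction c) (auto intro: computable_intros)

lemma computable_rec_nat:
  assumes "computable k G"
    and "computable (Suc (Suc k)) (\<lambda>f xs. S f (hd xs) (hd (tl xs)) (tl (tl xs)))"
    and "computable k N"
  shows "computable k (\<lambda>f xs. rec_nat (G f xs) (\<lambda>i r. S f i r xs) (N f xs))"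
proof -
  from assms(1,2) obtain p q where p: "\<And>f xs. length xs = k \<Longrightarrow> run p f xs = Some (G f xs)"
    and q: "\<And>f xs. length xs = Suc (Suc k) \<Longrightarrow>
      run q f xs = Some (S f (hd xs) (hd (tl xs)) (tl (tl xs)))"
    unfolding computable_def by blast
  have "run (PrimRec p q) f (n # ys) = Some (rec_nat (G f ys) (\<lambda>i r. S f i r ys) n)"
    if "length ys = k" for f n ys
    using that by (induction n) (simp_all add: p q)
  then have "computable (Suc k) (\<lambda>f xs. rec_nat (G f (tl xs)) (\<lambda>i r. S f i r (tl xs)) (hd xs))"
    unfolding computable_def by (intro exI[of _ "PrimRec p q"]) (auto simp: length_Suc_conv)
  \<comment> \<open>\<open>PrimRec\<close> recurses on its first argument, so the bound goes in
    front of the environment.\<close>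
  from computable_comp[OF this, of k "\<lambda>f xs. N f xs # xs"] assms(3) show ?thesis
    by (simp add: computable_intros)
qed

section \<open>Arithmetic, connectives and bounded quantifiers\<close>

lemma computable_add [computable_intros]:
  assumes "computable k F" and "computable k G"
  shows "computable k (\<lambda>f xs. F f xs + G f xs)"
proof -
  have "rec_nat a (\<lambda>i r. Suc r) b = a + b" for a b by (induction b) simp_all
  with computable_rec_nat[OF assms(1) _ assms(2), of "\<lambda>f i r xs. Suc r"] show ?thesis
    by (simp add: computable_intros)
qed

lemma computable_diff [computable_intros]:
  assumes "computable k F" and "computable k G"
  shows "computable k (\<lambda>f xs. F f xs - G f xs)"
proof -
  \<comment> \<open>Predecessor is a recursion that returns its counter; iterating it gives
    truncated subtraction.\<close>
  have "rec_nat 0 (\<lambda>i r. i) a = a - 1" for a :: nat by (cases a) simp_all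
  then have pred: "computable j (\<lambda>f xs. H f xs - 1)" if "computable j H" for j H
    using computable_rec_nat[OF computable_0 _ that, of "\<lambda>f i r xs. i"]
    by (simp add: computable_intros)
  have "rec_nat a (\<lambda>i r. r - 1) b = a - b" for a b :: nat by (induction b) simp_all
  with computable_rec_nat[OF assms(1) _ assms(2), of "\<lambda>f i r xs. r - 1"] show ?thesis
    using pred by (simp add: computable_intros)
qed

lemma computable_sum [computable_intros]:
  assumes "computable (Suc k) (\<lambda>f xs. G f (hd xs) (tl xs))" and "computable k N"
  shows "computable k (\<lambda>f xs. \<Sum>i<N f xs. G f i xs)"
proof -
  \<comment> \<open>In the recursion step the environment starts with the counter and the partial
    sum; \<open>G\<close> must skip the latter.\<close>
  have "computable (Suc (Suc k)) (\<lambda>f xs. G f (hd xs) (tl (tl xs)))"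
    using computable_comp[OF assms(1), of "Suc (Suc k)" "\<lambda>f xs. hd xs # tl (tl xs)"]
    by (simp add: computable_intros)
  then have "computable (Suc (Suc k)) (\<lambda>f xs. hd (tl xs) + G f (hd xs) (tl (tl xs)))"
    by (intro computable_intros)
  moreover have "rec_nat 0 (\<lambda>i r. r + h i) n = (\<Sum>i<n. h i)" for h :: "nat \<Rightarrow> nat" and n
    by (induction n) simp_all
  ultimately show ?thesis
    using computable_rec_nat[OF computable_0 _ assms(2), of "\<lambda>f i r xs. r + G f i xs"] by simp
qed

lemma computable_mult [computable_intros]:
  assumes "computable k F" and "computable k G"
  shows "computable k (\<lambda>f xs. F f xs * G f xs)"
  using computable_sum[OF computable_tl[OF assms(2)] assms(1)] by simp

lemma computable_power [computable_intros]:
  assumes "computable k F" and "computable k G"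
  shows "computable k (\<lambda>f xs. F f xs ^ G f xs)"
proof -
  have "computable (Suc (Suc k)) (\<lambda>f xs. F f (tl (tl xs)))"
    by (intro computable_tl assms)
  moreover have "rec_nat 1 (\<lambda>i r. a * r) b = a ^ b" for a b :: nat by (induction b) simp_all
  ultimately show ?thesis
    using computable_rec_nat[OF computable_const[of k 1] _ assms(2), of "\<lambda>f i r xs. F f xs * r"]
    by (simp add: computable_intros)
qed

lemma decidable_not [computable_intros]:
  assumes "decidable k P"
  shows "decidable k (\<lambda>f xs. \<not> P f xs)"
  using computable_diff[OF computable_const[of k 1] assms] by (rule computable_cong) simp

lemma decidable_conj [computable_intros]:
  "decidable k P \<Longrightarrow> decidable k Q \<Longrightarrow> decidable k (\<lambda>f xs. P f xs \<and> Q f xs)"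
  unfolding of_bool_conj by (intro computable_intros)

lemma decidable_disj [computable_intros]:
  assumes "decidable k P" and "decidable k Q"
  shows "decidable k (\<lambda>f xs. P f xs \<or> Q f xs)"
  using decidable_not[OF decidable_conj[OF assms[THEN decidable_not]]] by simp

lemma decidable_imp [computable_intros]:
  "decidable k P \<Longrightarrow> decidable k Q \<Longrightarrow> decidable k (\<lambda>f xs. P f xs \<longrightarrow> Q f xs)"
  unfolding imp_conv_disj by (intro computable_intros)

text \<open>By truncation, \<open>1 - (F - G)\<close> is the characteristic function.\<close>

lemma decidable_le [computable_intros]:
  assumes "computable k F" and "computable k G"
  shows "decidable k (\<lambda>f xs. F f xs \<le> G f xs)"
  using computable_diff[OF computable_const[of k 1] computable_diff[OF assms]]
  by (rule computable_cong) auto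

lemma decidable_less [computable_intros]:
  "computable k F \<Longrightarrow> computable k G \<Longrightarrow> decidable k (\<lambda>f xs. F f xs < G f xs)"
  unfolding less_eq_Suc_le by (intro computable_intros)

lemma decidable_eq [computable_intros]:
  "computable k F \<Longrightarrow> computable k G \<Longrightarrow> decidable k (\<lambda>f xs. F f xs = G f xs)"
  unfolding eq_iff by (intro computable_intros)

lemma decidable_all [computable_intros]:
  assumes "decidable (Suc k) (\<lambda>f xs. P f (hd xs) (tl xs))" and "computable k N"
  shows "decidable k (\<lambda>f xs. \<forall>i<N f xs. P f i xs)"
proof (rule computable_cong)
  \<comment> \<open>The number of counterexamples is a bounded sum; the quantifier holds exactly
    when it vanishes.\<close>
  show "decidable k (\<lambda>f xs. (\<Sum>i<N f xs. of_bool (\<not> P f i xs)) = (0::nat))"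
    using assms by (intro computable_intros)
qed (auto simp del: sum_of_bool_eq)

lemma decidable_ex [computable_intros]:
  assumes "decidable (Suc k) (\<lambda>f xs. P f (hd xs) (tl xs))" and "computable k N"
  shows "decidable k (\<lambda>f xs. \<exists>i<N f xs. P f i xs)"
  using decidable_not[OF decidable_all[OF decidable_not[OF assms(1)] assms(2)]] by simp

lemma computable_if [computable_intros]:
  assumes "decidable k P" and "computable k F" and "computable k G"
  shows "computable k (\<lambda>f xs. if P f xs then F f xs else G f xs)"
proof (rule computable_cong)
  show "computable k (\<lambda>f xs. of_bool (P f xs) * F f xs + of_bool (\<not> P f xs) * G f xs)"
    using assms by (intro computable_intros)
qed simp

text \<open>The list is fixed outside the computation, so the program is a finite disjunction built
  along it.\<close>

lemma decidable_list_ex: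
  assumes "\<And>q. q \<in> set qs \<Longrightarrow> decidable k (P q)"
  shows "decidable k (\<lambda>f xs. \<exists>q\<in>set qs. P q f xs)"
  using assms
proof (induction qs)
  case (Cons q qs)
  then have "decidable k (\<lambda>f xs. P q f xs \<or> (\<exists>q\<in>set qs. P q f xs))"
    by (intro decidable_disj) simp_all
  then show ?case unfolding list.set bex_simps .
qed (simp add: computable_const)

text \<open>Bit \<open>x\<close> of \<open>c\<close> is 1 exactly when the quotient by
  \<open>2 ^ x\<close> is odd. Bounded quantifiers, sums, products and powers express this in a form
  that the rules above decide.\<close>

lemma set_decode_iff: "x \<in> set_decode c \<longleftrightarrow> (\<exists>q<Suc c. \<exists>r<2 ^ x. c = (q + q + 1) * 2 ^ x + r)"
proof
  assume "x \<in> set_decode c"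
  then have "odd (c div 2 ^ x)" by (simp add: set_decode_def)
  then obtain q where q: "c div 2 ^ x = 2 * q + 1" by (rule oddE)
  then have "c = (q + q + 1) * 2 ^ x + c mod 2 ^ x"
    by (metis div_mult_mod_eq mult_2)
  moreover have "q < Suc c"
    using q div_le_dividend[of c "2 ^ x"] by linarith
  ultimately show "\<exists>q<Suc c. \<exists>r<2 ^ x. c = (q + q + 1) * 2 ^ x + r"
    by (meson mod_less_divisor pos2 zero_less_power)
next
  assume "\<exists>q<Suc c. \<exists>r<2 ^ x. c = (q + q + 1) * 2 ^ x + r"
  then obtain q r where r: "r < 2 ^ x" and c: "c = r + (q + q + 1) * 2 ^ x"
    by (metis add.commute)
  have "c div 2 ^ x = q + q + 1"
    unfolding c using r by (subst div_mult_self1) simp_all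
  then show "x \<in> set_decode c" by (simp add: set_decode_def)
qed

lemma decidable_set_decode [computable_intros]:
  assumes "computable k F" and "computable k G"
  shows "decidable k (\<lambda>f xs. F f xs \<in> set_decode (G f xs))"
  unfolding set_decode_iff
  using assms by (intro computable_intros computable_tl)


text \<open>A divergent bounded run is coded as \<open>0\<close> and the value \<open>v\<close> as \<open>Suc v\<close>; the oracle is the finite
  set with code \<open>c\<close>.\<close>

definition run_code :: "prog \<Rightarrow> nat \<Rightarrow> nat \<Rightarrow> nat list \<Rightarrow> nat" where
  "run_code p s c xs =
     case_option 0 Suc (bounded_run p {..<s} (indicator (set_decode c)) xs)"

lemma run_code_eq_0_iff:
  "run_code p s c xs = 0 \<longleftrightarrow> bounded_run p {..<s} (indicator (set_decode c)) xs = None"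
  by (simp add: run_code_def split: option.splits)

lemma run_code_eq_Suc_iff:
  "run_code p s c xs = Suc v \<longleftrightarrow> bounded_run p {..<s} (indicator (set_decode c)) xs = Some v"
  by (simp add: run_code_def split: option.splits)

section \<open>Recursion equations for coded bounded runs\<close>

lemma those_eq_None_iff: "those xs = None \<longleftrightarrow> None \<in> set xs"
  by (induction xs) (auto split: option.splits)

text \<open>This and the analogous equations for \<open>PrimRec\<close> and \<open>Mu\<close> use
  only total operations on codes, as the induction in \<open>computable_run_code\<close> requires.
  Past the divergence test all codes are positive, so subtracting 1 recovers the values.\<close>

lemma run_code_Comp:
  "run_code (Comp p qs) s c xs =
     (if \<exists>q\<in>set qs. run_code q s c xs = 0 then 0
      else run_code p s c (map (\<lambda>q. run_code q s c xs - 1) qs))"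
proof -
  let ?r = "\<lambda>q. bounded_run q {..<s} (indicator (set_decode c)) xs"
  show ?thesis
  proof (cases "\<exists>q\<in>set qs. ?r q = None")
    case True
    then have "those (map ?r qs) = None"
      unfolding those_eq_None_iff by force
    with True show ?thesis
      by (simp add: run_code_eq_0_iff bounded_run.simps(5) comp_def)
  next
    case False
    then have "those (map ?r qs) = Some (map (\<lambda>q. run_code q s c xs - 1) qs)"
      unfolding those_eq_Some_iff by (auto simp: run_code_def)
    then have "run_code (Comp p qs) s c xs = run_code p s c (map (\<lambda>q. run_code q s c xs - 1) qs)"
      by (simp add: run_code_def bounded_run.simps(5) comp_def)
    with False show ?thesis
      unfolding run_code_eq_0_iff by (simp only: if_False)
  qed
qed

lemma run_code_PrimRec:
  "run_code (PrimRec p q) s c (n # ys) =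
     rec_nat (run_code p s c ys)
       (\<lambda>i r. if r = 0 then 0 else run_code q s c (i # (r - 1) # ys)) n"
proof -
  let ?B = "{..<s}" and ?g = "indicator (set_decode c)"
  have "rec_nat (run_code p s c ys)
      (\<lambda>i r. if r = 0 then 0 else run_code q s c (i # (r - 1) # ys)) n =
    case_option 0 Suc (rec_nat (bounded_run p ?B ?g ys)
      (\<lambda>k r. Option.bind r (\<lambda>v. bounded_run q ?B ?g (k # v # ys))) n)"
  proof (induction n)
    case (Suc n)
    then show ?case by (simp add: run_code_def split: option.splits)
  qed (simp add: run_code_def)
  then show ?thesis by (simp add: run_code_def)
qed

lemma one_less_run_code_iff:
  "1 < run_code p s c xs \<longleftrightarrow>
     (\<exists>v. bounded_run p {..<s} (indicator (set_decode c)) xs = Some (Suc v))"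
  by (auto simp: run_code_def gr0_conv_Suc split: option.splits)

text \<open>At most one \<open>n\<close> is a first zero, so at most one summand is nonzero. Code 1
  stands for the value 0, larger codes for positive values.\<close>

lemma run_code_Mu:
  "run_code (Mu p) s c xs =
     (\<Sum>n<s. if run_code p s c (n # xs) = 1 \<and> (\<forall>m<n. 1 < run_code p s c (m # xs)) then Suc n else 0)"
proof -
  let ?g = "\<lambda>n. bounded_run p {..<s} (indicator (set_decode c)) (n # xs)"
  have *: "run_code p s c (n # xs) = 1 \<and> (\<forall>m<n. 1 < run_code p s c (m # xs)) \<longleftrightarrow> first_zero ?g n"
    for n
    unfolding first_zero_def one_less_run_code_iff
    unfolding One_nat_def run_code_eq_Suc_iff ..
  show ?thesis
  proof (cases "\<exists>n\<in>{..<s}. first_zero ?g n")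
    case True
    then obtain n where n: "n < s" "first_zero ?g n" by blast
    then have "first_zero ?g m \<longleftrightarrow> m = n" for m using first_zero_unique by blast
    moreover have "run_code (Mu p) s c xs = Suc n"
      unfolding run_code_eq_Suc_iff bounded_run_Mu_eq_Some_iff using n by simp
    ultimately show ?thesis using n(1) unfolding * by simp
  next
    case False
    then have "run_code (Mu p) s c xs = 0"
      by (simp add: run_code_def bounded_run.simps(7))
    with False show ?thesis unfolding * by simp
  qed
qed

text \<open>The program \<open>p\<close> is fixed, so induction on it takes the place of a universal
  machine. The arity stays arbitrary because subprograms are run on lists of other lengths.\<close>

lemma computable_run_code:
  "computable (Suc (Suc k)) (\<lambda>f xs. run_code p (hd xs) (hd (tl xs)) (tl (tl xs)))"
proof (induction p arbitrary: k)
  case Zero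
  have "run_code Zero s c xs = 1" for s c xs by (simp add: run_code_def)
  then show ?case by (simp add: computable_intros)
next
  case Succ
  show ?case
  proof (rule computable_cong)
    \<comment> \<open>Entries 0 and 1 hold the bound and the oracle code, so entry 2 is the sole
      argument. One \<open>Suc\<close> comes from the program, the other from the code.\<close>
    show "computable (Suc (Suc k)) (\<lambda>f xs. if k = 1 then Suc (Suc (xs ! 2)) else 0)"
      by (cases "k = 1") (simp_all add: computable_Suc computable_nth computable_0)
  qed (auto simp: run_code_def length_Suc_conv split: list.splits)
next
  case (Proj i)
  show ?case
  proof (rule computable_cong)
    show "computable (Suc (Suc k)) (\<lambda>f xs. if i < k then Suc (xs ! Suc (Suc i)) else 0)"
      by (cases "i < k") (simp_all add: computable_Suc computable_nth computable_0)
  qed (auto simp: run_code_def length_Suc_conv)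
next
  case Query
  show ?case
  proof (rule computable_cong)
    show "computable (Suc (Suc k)) (\<lambda>f xs. if k = 1 \<and> xs ! 2 < xs ! 0
        then Suc (of_bool (xs ! 2 \<in> set_decode (xs ! 1))) else 0)"
    proof (cases "k = 1")
      case True
      then show ?thesis by (auto intro!: computable_intros computable_nth)
    qed (simp add: computable_0)
  qed (auto simp: run_code_def length_Suc_conv split: list.splits)
next
  case (Comp p qs)
  have "computable_list (Suc (Suc k)) (Suc (Suc (length qs))) (\<lambda>f xs. hd xs # hd (tl xs) #
      map (\<lambda>q. run_code q (hd xs) (hd (tl xs)) (tl (tl xs)) - 1) qs)"
    using Comp.IH(2) by (intro computable_intros computable_list_map) auto
  from computable_comp[OF Comp.IH(1) this] Comp.IH(2) show ?case
    unfolding run_code_Comp by (intro computable_intros decidable_list_ex) simp_all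
next
  case (PrimRec p q)
  show ?case
  proof (cases k)
    case 0
    show ?thesis
      by (rule computable_cong[OF computable_0]) (auto simp: 0 run_code_def length_Suc_conv)
  next
    case (Suc j)
    have p: "computable (Suc (Suc k))
        (\<lambda>f xs. run_code p (hd xs) (hd (tl xs)) (tl (tl (tl xs))))"
      using computable_comp[OF PrimRec.IH(1)[of j], of "Suc (Suc k)"
          "\<lambda>f xs. hd xs # hd (tl xs) # tl (tl (tl xs))"]
      by (simp add: Suc computable_intros)
    \<comment> \<open>Here the environment is \<open>i\<close>, \<open>r\<close>, \<open>s\<close>,
      \<open>c\<close>, \<open>n\<close> and then the parameters; \<open>r - 1\<close> decodes the
      previous value.\<close>
    have q: "computable (Suc (Suc (Suc (Suc k)))) (\<lambda>f xs.
        run_code q (hd (tl (tl xs))) (hd (tl (tl (tl xs))))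
          (hd xs # (hd (tl xs) - 1) # tl (tl (tl (tl (tl xs))))))"
      using computable_comp[OF PrimRec.IH(2)[of "Suc (Suc j)"], of "Suc (Suc (Suc (Suc k)))"
          "\<lambda>f xs. hd (tl (tl xs)) # hd (tl (tl (tl xs))) # hd xs # (hd (tl xs) - 1) #
             tl (tl (tl (tl (tl xs))))"] computable_list_funpow_tl[of j 5]
      by (simp add: Suc computable_intros numeral_eq_Suc)
    show ?thesis
    proof (rule computable_cong)
      show "computable (Suc (Suc k)) (\<lambda>f xs.
          rec_nat (run_code p (hd xs) (hd (tl xs)) (tl (tl (tl xs))))
            (\<lambda>i r. if r = 0 then 0
               else run_code q (hd xs) (hd (tl xs)) (i # (r - 1) # tl (tl (tl xs))))
            (hd (tl (tl xs))))"
        unfolding Suc using p q by (intro computable_rec_nat computable_intros) (simp_all add: Suc)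
    qed (auto simp: run_code_PrimRec Suc length_Suc_conv cong: if_cong)
  qed
next
  case (Mu p)
  have p: "computable (Suc (Suc (Suc k)))
      (\<lambda>f xs. run_code p (hd (tl xs)) (hd (tl (tl xs))) (hd xs # tl (tl (tl xs))))"
    using computable_comp[OF Mu.IH[of "Suc k"], of "Suc (Suc (Suc k))"
        "\<lambda>f xs. hd (tl xs) # hd (tl (tl xs)) # hd xs # tl (tl (tl xs))"]
    by (simp add: computable_intros)
  \<comment> \<open>The inner quantifier over \<open>m\<close> adds a second bound variable, hence a
    shifted copy of the previous fact.\<close>
  have p': "computable (Suc (Suc (Suc (Suc k))))
      (\<lambda>f xs. run_code p (hd (tl (tl xs))) (hd (tl (tl (tl xs)))) (hd xs # tl (tl (tl (tl xs)))))"
    using computable_comp[OF Mu.IH[of "Suc k"], of "Suc (Suc (Suc (Suc k)))"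
        "\<lambda>f xs. hd (tl (tl xs)) # hd (tl (tl (tl xs))) # hd xs # tl (tl (tl (tl xs)))"]
    by (simp add: computable_intros)
  show ?case
    unfolding run_code_Mu by (intro computable_intros p p')
qed

section \<open>Forcing a computation on subsets of finite sets\<close>

lemma set_encode_less:
  assumes "A \<subseteq> {..<N}"
  shows "set_encode A < 2 ^ N"
proof -
  have "set_encode A \<le> (\<Sum>i<N. 2 ^ i)"
    unfolding set_encode_def using assms by (intro sum_mono2) auto
  also have "\<dots> < 2 ^ N"
    by (induction N) simp_all
  finally show ?thesis .
qed

text \<open>The compactness of Cantor space, in the form of cluster points.\<close>

lemma ex_set_cluster_point:
  fixes X :: "nat \<Rightarrow> nat set"
  obtains Y where "\<And>m. infinite {N. X N \<inter> {..<m} = Y \<inter> {..<m}}"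
proof -
  let ?P = "\<lambda>m S. S \<subseteq> {..<m} \<and> infinite {N. X N \<inter> {..<m} = S}"
  \<comment> \<open>Koenig's lemma: \<open>S m\<close> is extended by one decision at a time and
    stays the trace of infinitely many of the \<open>X N\<close>.\<close>
  have "\<exists>S. \<forall>m. ?P m (S m) \<and> S (Suc m) \<inter> {..<m} = S m"
  proof (rule dependent_nat_choice[where P = ?P and Q = "\<lambda>m S S'. S' \<inter> {..<m} = S"])
    show "\<exists>S. ?P 0 S" by auto
  next
    fix S m assume S: "?P m S"
    have "{N. X N \<inter> {..<m} = S} \<subseteq>
        {N. X N \<inter> {..<Suc m} = S} \<union> {N. X N \<inter> {..<Suc m} = insert m S}"
      by (auto simp: lessThan_Suc)
    with S have "infinite {N. X N \<inter> {..<Suc m} = S} \<or> infinite {N. X N \<inter> {..<Suc m} = insert m S}"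
      by (meson finite_UnI finite_subset)
    moreover have "S \<inter> {..<m} = S" "insert m S \<inter> {..<m} = S"
      "S \<subseteq> {..<Suc m}" "insert m S \<subseteq> {..<Suc m}"
      using S by auto
    ultimately show "\<exists>S'. ?P (Suc m) S' \<and> S' \<inter> {..<m} = S"
      by blast
  qed
  then obtain S where S: "\<And>m. ?P m (S m)" "\<And>m. S (Suc m) \<inter> {..<m} = S m"
    by blast
  have step: "x \<in> S (Suc m) \<longleftrightarrow> x \<in> S m" if "x < m" for x m
    using S(2)[of m] that by blast
  \<comment> \<open>Whether \<open>x\<close> belongs is settled at stage \<open>Suc x\<close> and
    never revised.\<close>
  have "x \<in> S m \<longleftrightarrow> x \<in> S (Suc x)" if "x < m" for x m
    using that by (induction m) (auto simp: step less_Suc_eq)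
  then have "{x. x \<in> S (Suc x)} \<inter> {..<m} = S m" for m
    using S(1)[of m] by blast
  with S(1) show thesis
    by (intro that[of "{x. x \<in> S (Suc x)}"]) simp
qed

text \<open>Only intervals with both ends below \<open>N\<close> are tested: if \<open>f\<close>
  dominates the principal function of \<open>H\<close>, then \<open>H \<inter> {..<N}\<close> passes
  at every stage, and a cluster point of passing sets meets every interval. The bound
  \<open>x < N\<close> brings the quantifier under \<open>decidable_ex\<close>.\<close>

definition meets_intervals :: "(nat \<Rightarrow> nat) \<Rightarrow> nat \<Rightarrow> nat set \<Rightarrow> bool" where
  "meets_intervals f N S \<longleftrightarrow> (\<forall>a<N. f a < N \<longrightarrow> (\<exists>x<N. a \<le> x \<and> x \<le> f a \<and> x \<in> S))"

text \<open>Subsets of \<open>{..<N}\<close> are quantified through their codes below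
  \<open>2 ^ N\<close>, and inclusion is tested below \<open>N\<close>, so that all quantifiers are
  bounded and the relation is decidable in \<open>f\<close>.\<close>

definition forced :: "prog \<Rightarrow> nat \<Rightarrow> (nat \<Rightarrow> nat) \<Rightarrow> nat \<Rightarrow> nat \<Rightarrow> bool" where
  "forced p i f N n \<longleftrightarrow> (\<forall>c<2 ^ N. meets_intervals f N (set_decode c) \<longrightarrow>
     (\<exists>d<2 ^ N. (\<forall>x<N. x \<in> set_decode d \<longrightarrow> x \<in> set_decode c) \<and> run_code p N d [n] = Suc i))"

lemma decidable_forced: "decidable 2 (\<lambda>f xs. forced p i f (hd xs) (hd (tl xs)))"
proof -
  \<comment> \<open>The environment under both quantifiers over codes is \<open>d\<close>,
    \<open>c\<close>, \<open>N\<close>, \<open>n\<close>.\<close>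
  have "computable (Suc (Suc (Suc (Suc 0))))
      (\<lambda>f xs. run_code p (hd (tl (tl xs))) (hd xs) [hd (tl (tl (tl xs)))])"
    using computable_comp[OF computable_run_code[of 1], of "Suc (Suc (Suc (Suc 0)))"
        "\<lambda>f xs. [hd (tl (tl xs)), hd xs, hd (tl (tl (tl xs)))]"]
    by (simp add: computable_intros)
  then show ?thesis
    unfolding forced_def meets_intervals_def numeral_2_eq_2 by (intro computable_intros)
qed

lemma set_decode_subset_lessThan:
  assumes "c < 2 ^ N"
  shows "set_decode c \<subseteq> {..<N}"
proof
  fix x assume "x \<in> set_decode c"
  then have "2 ^ x \<le> c"
    by (intro leI) (auto simp: set_decode_def)
  from this assms have "(2::nat) ^ x < 2 ^ N" by (rule order_le_less_trans)
  then show "x \<in> {..<N}" by simp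
qed

lemma forced_iff:
  "forced p i f N n \<longleftrightarrow> (\<forall>S\<subseteq>{..<N}. meets_intervals f N S \<longrightarrow>
     (\<exists>F\<subseteq>S. bounded_run p {..<N} (indicator F) [n] = Some i))"
proof (intro iffI allI impI)
  fix S assume forced: "forced p i f N n" and S: "S \<subseteq> {..<N}" "meets_intervals f N S"
  then have "set_decode (set_encode S) = S" "set_encode S < 2 ^ N"
    using finite_subset[OF S(1)] set_encode_less by simp_all
  with forced S(2) obtain d where d: "d < 2 ^ N" "\<And>x. x < N \<Longrightarrow> x \<in> set_decode d \<Longrightarrow> x \<in> S"
    "run_code p N d [n] = Suc i"
    unfolding forced_def by metis
  have "set_decode d \<subseteq> S"
    using d(2) set_decode_subset_lessThan[OF d(1)] by blast
  with d(3) show "\<exists>F\<subseteq>S. bounded_run p {..<N} (indicator F) [n] = Some i"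
    unfolding run_code_eq_Suc_iff by blast
next
  assume *: "\<forall>S\<subseteq>{..<N}. meets_intervals f N S \<longrightarrow>
     (\<exists>F\<subseteq>S. bounded_run p {..<N} (indicator F) [n] = Some i)"
  show "forced p i f N n"
    unfolding forced_def
  proof (intro allI impI)
    fix c :: nat assume "c < 2 ^ N" and "meets_intervals f N (set_decode c)"
    with * set_decode_subset_lessThan[OF this(1)] obtain F
      where F: "F \<subseteq> set_decode c" "bounded_run p {..<N} (indicator F) [n] = Some i"
      by blast
    then have "F \<subseteq> {..<N}"
      using set_decode_subset_lessThan[OF \<open>c < 2 ^ N\<close>] by blast
    then have "set_decode (set_encode F) = F" "set_encode F < 2 ^ N"
      using finite_subset[of F "{..<N}"] set_encode_less by simp_all
    with F have "run_code p N (set_encode F) [n] = Suc i"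
      by (simp only: run_code_eq_Suc_iff)
    with F(1) \<open>set_decode (set_encode F) = F\<close> \<open>set_encode F < 2 ^ N\<close>
    show "\<exists>d<2 ^ N. (\<forall>x<N. x \<in> set_decode d \<longrightarrow> x \<in> set_decode c) \<and> run_code p N d [n] = Suc i"
      by blast
  qed
qed

lemma forced_if_dense:
  assumes dense: "\<And>X. infinite X \<Longrightarrow> \<exists>Y\<subseteq>X. run p (indicator Y) [n] = Some i"
  shows "\<exists>N. forced p i f N n"
proof (rule ccontr)
  assume "\<nexists>N. forced p i f N n"
  then have "\<forall>N. \<exists>S\<subseteq>{..<N}. meets_intervals f N S
      \<and> (\<forall>F\<subseteq>S. bounded_run p {..<N} (indicator F) [n] \<noteq> Some i)"
    by (simp add: forced_iff)
  from choice[OF this] obtain S where S: "\<And>N. meets_intervals f N (S N)"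
    "\<And>N F. F \<subseteq> S N \<Longrightarrow> bounded_run p {..<N} (indicator F) [n] \<noteq> Some i"
    by blast
  obtain X where X: "\<And>m. infinite {N. S N \<inter> {..<m} = X \<inter> {..<m}}"
    using ex_set_cluster_point[of S] by blast
  have large: "\<exists>N>k. S N \<inter> {..<m} = X \<inter> {..<m}" for k m
    using X[of m] unfolding infinite_nat_iff_unbounded by blast
  have "\<exists>x\<ge>a. x \<in> X" for a
  proof -
    \<comment> \<open>At a stage past \<open>a\<close> and \<open>f a\<close> the interval is
      tested, and agreement up to \<open>f a\<close> transfers the point met to
      \<open>X\<close>.\<close>
    obtain N where N: "N > max a (f a)" "S N \<inter> {..<Suc (f a)} = X \<inter> {..<Suc (f a)}"
      using large[of "max a (f a)" "Suc (f a)"] by blast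
    then have "a < N" "f a < N" by simp_all
    then obtain x where "a \<le> x" "x \<le> f a" "x \<in> S N"
      using S(1)[unfolded meets_intervals_def, rule_format, of a N] by blast
    with N(2) have "x \<in> X" by (metis IntD1 IntI lessThan_iff less_Suc_eq_le)
    with \<open>a \<le> x\<close> show ?thesis by blast
  qed
  then have "infinite X"
    unfolding infinite_nat_iff_unbounded_le by blast
  then obtain Y where Y: "Y \<subseteq> X" "run p (indicator Y) [n] = Some i"
    using dense by blast
  from eventually_bounded_run[OF Y(2)]
  obtain s where s: "bounded_run p {..<s} (indicator Y) [n] = Some i"
    using eventually_happens'[OF sequentially_bot] by blast
  \<comment> \<open>All queries and searches stay below \<open>s\<close>. Beyond \<open>s\<close>
    the set \<open>S N\<close> may differ from \<open>X\<close>, so \<open>Y\<close> is cut off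
    there.\<close>
  obtain N where N: "N > s" "S N \<inter> {..<s} = X \<inter> {..<s}"
    using large[of s s] by blast
  have "bounded_run p {..<N} (indicator (Y \<inter> {..<s})) [n] = Some i"
    using s N(1) by (elim bounded_run_mono) (auto simp: indicator_def)
  moreover have "Y \<inter> {..<s} \<subseteq> S N"
    using Y(1) N(2) by blast
  ultimately show False
    using S(2) by blast
qed

text \<open>A subset \<open>F\<close> found at stage \<open>N\<close> can be extended by the tail of
  \<open>H\<close> from \<open>N\<close> on: the computation never looks there, and the set becomes
  infinite.\<close>

lemma forced_imp_run:
  assumes "forced p i f N n" and "infinite H" and "dominates f (principal_function H)"
  obtains Y where "Y \<subseteq> H" and "infinite Y" and "run p (indicator Y) [n] = Some i"
proof -
  have "meets_intervals f N (H \<inter> {..<N})"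
    unfolding meets_intervals_def
  proof (intro allI impI)
    fix a assume "f a < N"
    \<comment> \<open>Domination puts element number \<open>a\<close> of \<open>H\<close> into the
      interval from \<open>a\<close> to \<open>f a\<close>.\<close>
    have "a \<le> enumerate H a" "enumerate H a \<le> f a" "enumerate H a \<in> H"
      using assms(3) enumerate_in_set[OF assms(2)] le_enumerate[OF assms(2)]
      by (simp_all add: dominates_def principal_function_def)
    with \<open>f a < N\<close> show "\<exists>x<N. a \<le> x \<and> x \<le> f a \<and> x \<in> H \<inter> {..<N}"
      by (intro exI[of _ "enumerate H a"]) simp
  qed
  with assms(1)[unfolded forced_iff, rule_format, of "H \<inter> {..<N}"]
  obtain F where F: "F \<subseteq> H \<inter> {..<N}" "bounded_run p {..<N} (indicator F) [n] = Some i"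
    by blast
  define Y where "Y = F \<union> (H - {..<N})"
  have "bounded_run p UNIV (indicator Y) [n] = Some i"
    using F(2) by (rule bounded_run_mono) (auto simp: Y_def indicator_def)
  then have "run p (indicator Y) [n] = Some i"
    by (simp add: bounded_run_UNIV)
  moreover have "Y \<subseteq> H" "infinite Y"
    using F(1) assms(2) by (auto simp: Y_def)
  ultimately show thesis
    by (intro that)
qed

section \<open>The search algorithm and its correctness\<close>

theorem theorem2p5:
  fixes A :: "nat set" and C :: "nat set set"
  assumes "C \<subseteq> infinite_subsets UNIV"
    and "ramsey_like C"
    and "\<exists>\<Phi>. turing_functional \<Phi> \<and> (\<forall>H \<in> C. computes_set \<Phi> (indicator H) A)"
  shows "\<forall>H \<in> C. uniform_modulus (principal_function H) A"
proof
  fix H assume "H \<in> C"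
  from assms(3) obtain p where p: "\<And>Y n. Y \<in> C \<Longrightarrow> run p (indicator Y) [n] = Some (indicator A n)"
    unfolding turing_functional_def computes_set_def by fastforce
  have "infinite H"
    using assms(1) \<open>H \<in> C\<close> unfolding infinite_subsets_def by blast
  \<comment> \<open>\<open>Mu\<close> looks for a zero, hence the negation: the value is 0 exactly
    at the stages where some bit is forced.\<close>
  have "decidable 2 (\<lambda>f xs. \<not> (forced p 1 f (hd xs) (hd (tl xs)) \<or> forced p 0 f (hd xs) (hd (tl xs))))"
    by (intro computable_intros decidable_forced)
  then obtain search where "\<And>f xs. length xs = 2 \<Longrightarrow> run search f xs = Some (of_bool
      (\<not> (forced p 1 f (hd xs) (hd (tl xs)) \<or> forced p 0 f (hd xs) (hd (tl xs)))))"
    unfolding computable_def by blast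
  from this[of "[_, _]"] have search: "run search f [N, n] =
      Some (of_bool (\<not> (forced p 1 f N n \<or> forced p 0 f N n)))" for f N n
    by simp
  obtain out where "\<And>f xs. length xs = 2 \<Longrightarrow>
      run out f xs = Some (of_bool (forced p 1 f (hd xs) (hd (tl xs))))"
    using decidable_forced[of p 1] unfolding computable_def by blast
  from this[of "[_, _]"] have out: "run out f [N, n] = Some (of_bool (forced p 1 f N n))" for f N n
    by simp
  \<comment> \<open>On input \<open>n\<close>, \<open>Mu search\<close> yields a stage and
    \<open>Proj 0\<close> passes \<open>n\<close> on. The program is built from \<open>p\<close>
    alone and is the same for every \<open>f\<close>, which gives uniformity.\<close>
  define q where "q = Comp out [Mu search, Proj 0]"
  have "run q f [n] = Some (indicator A n)" if f: "dominates f (principal_function H)" for f n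
  proof -
    have "\<exists>Y\<subseteq>X. run p (indicator Y) [n] = Some (indicator A n)" if "infinite X" for X
      using assms(2) that p unfolding ramsey_like_def dense_class_def infinite_subsets_def by blast
    then have "\<exists>N. forced p (indicator A n) f N n"
      by (rule forced_if_dense)
    then have ex: "\<exists>N. forced p 1 f N n \<or> forced p 0 f N n"
      by (cases "n \<in> A") auto
    have unique: "i = indicator A n" if i: "forced p i f N n" for i N
    proof -
      obtain Y where "Y \<subseteq> H" "infinite Y" "run p (indicator Y) [n] = Some i"
        using forced_imp_run[OF i \<open>infinite H\<close> f] by blast
      moreover from this have "Y \<in> C"
        using assms(2) \<open>H \<in> C\<close> unfolding ramsey_like_def downward_closed_def infinite_subsets_def
        by blast
      ultimately show ?thesis using p by simp
    qed
    define N where "N = (LEAST N. forced p 1 f N n \<or> forced p 0 f N n)"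
    have N: "forced p 1 f N n \<or> forced p 0 f N n"
      unfolding N_def using ex by (rule LeastI_ex)
    have "run (Mu search) f [n] = Some N"
      using ex by (simp add: search N_def)
    then have "run q f [n] = Some (of_bool (forced p 1 f N n))"
      by (simp add: q_def out)
    \<comment> \<open>If 1 is not forced at \<open>N\<close>, then 0 is. By \<open>unique\<close> a
      forced bit is the value of \<open>A\<close> at \<open>n\<close>, so testing for 1
      decides.\<close>
    also have "of_bool (forced p 1 f N n) = (indicator A n :: nat)"
      using N unique[of 1 N] unique[of 0 N] by auto
    finally show ?thesis .
  qed
  then show "uniform_modulus (principal_function H) A"
    unfolding uniform_modulus_def turing_functional_def computes_set_def
    by (intro exI[of _ "\<lambda>f n. run q f [n]"]) blast
qed

end
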